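(* Let $G:\mathbb{R}^d\to[0,\infty)$ satisfy the standing assumptions listed in the context and let $t>0$. For $T>0$ define the diffusion potential with temperature $T$ by $$G_T^t(x)=-T\log\left(\frac1{(2\pi Tt)^{d/2}}\int_{\mathbb{R}^d}\exp\left(-\frac{G(y)}{T}-\frac1{2Tt}\|x-y\|^2\right)dy\right).$$ Then the gradient $\nabla M_G^t$ of the Moreau envelope is obtained as the zero-temperature limit of the diffusion score $\nabla G_T^t$, that is, $\nabla G_T^t(x)\to\nabla M_G^t(x)$ as $T\to0^+$ for any $x\in\mathbb{R}^d$. In addition, if $G$ is differentiable and $\nabla G$ is locally Lipschitz continuous, the convergence is uniform on compact sets.
   Context: Notation: $B_R(m)=\{x\in\mathbb{R}^d:\|x-m\|\le R\}$ and $B_R^c(m)=\mathbb{R}^d\setminus B_R(m)$. The (regular) subdifferential of $H:\mathbb{R}^d\to\mathbb{R}$ at $x$ is $\partial H(x)=\{v\in\mathbb{R}^d:\liminf_{y\to x,\,y\ne x}\frac{H(y)-H(x)-\langle v,y-x\rangle}{\|y-x\|}\ge 0\}$. For $t>0$ the Moreau envelope is $M_H^t(x)=\inf_{y\in\mathbb{R}^d}H(y)+\frac1{2t}\|x-y\|^2$ and the proximal map is $\operatorname{prox}_{tH}(x)=\operatorname{argmin}_{y\in\mathbb{R}^d}H(y)+\frac1{2t}\|x-y\|^2$. Standing assumptions (the setting in which the whole potential is $U=G$): $\int\exp(-G(x))\,dx<\infty$, and (1) $G$ is locally bounded and weakly convex: there is $\rho_G>0$ such that $G+\frac{\rho_G}{2}\|\cdot\|^2$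 is convex. (2) $G$ is convex outside a ball: there is $M>0$ such that for all $x,y\in B_M^c(0)$ and $\lambda\in[0,1]$, $G(\lambda x+(1-\lambda)y)\le\lambda G(x)+(1-\lambda)G(y)$. (3) For a fixed $0<t_{\max}<1/\rho_G$ and $\phi(s)=\sup\{\|p\|: p\in\partial G(\operatorname{prox}_{tG}(x)),\ \|x\|\le s,\ 0<t\le t_{\max}\}$, it holds that $\int\phi(\|x\|)^2\exp(-M_G^{t_{\max}}(x))\,dx<\infty$.
   Formalization: For t ≥ 1/ρ_G the gradient of M_G^t may fail to exist, so convergence is stated at points x, and on compact sets, where M_G^t is differentiable; for t < 1/ρ_G this is shown to be all of R^d. *)

theory Defs
  imports "HOL-Analysis.Analysis"
begin

text \<open>The gradient is only meaningful at points of differentiability; elsewhere it is an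
  unspecified vector.\<close>

definition gradient :: "('a::real_inner \<Rightarrow> real) \<Rightarrow> 'a \<Rightarrow> 'a" where
  "gradient f x = (THE D. GDERIV f x :> D)"

definition locally_bounded :: "('a::metric_space \<Rightarrow> 'b::metric_space) \<Rightarrow> bool" where
  "locally_bounded f \<longleftrightarrow> (\<forall>x. \<exists>e>0. bounded (f ` ball x e))"

definition locally_lipschitz :: "('a::metric_space \<Rightarrow> 'b::metric_space) \<Rightarrow> bool" where
  "locally_lipschitz f \<longleftrightarrow> (\<forall>x. \<exists>e>0. \<exists>L. L-lipschitz_on (ball x e) f)"

text \<open>The filter \<^term>\<open>at x\<close> is the punctured neighbourhood filter, so \<open>y = x\<close> is excluded
  in the lower limit, which is taken in the extended reals.\<close>

definition regular_subdifferential :: "('a::real_inner \<Rightarrow> real) \<Rightarrow> 'a \<Rightarrow> 'a set" where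
  "regular_subdifferential H x =
     {v. 0 \<le> Liminf (at x) (\<lambda>y. ereal ((H y - H x - v \<bullet> (y - x)) / norm (y - x)))}"

text \<open>The infimum is that of the reals, hence meaningful only if the objective is bounded below;
  this is the case for nonnegative \<open>H\<close>.\<close>

definition moreau_envelope :: "('a::real_normed_vector \<Rightarrow> real) \<Rightarrow> real \<Rightarrow> 'a \<Rightarrow> real" where
  "moreau_envelope H t x = (INF y. H y + 1 / (2 * t) * (norm (x - y))\<^sup>2)"

text \<open>The full set of minimisers; it is a singleton if \<open>H\<close> is \<open>\<rho>\<close>-weakly convex on a
  Euclidean space and \<open>0 < t < 1 / \<rho>\<close>.\<close>

definition prox :: "('a::real_normed_vector \<Rightarrow> real) \<Rightarrow> real \<Rightarrow> 'a \<Rightarrow> 'a set" where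
  "prox H t x = {y. is_arg_min (\<lambda>z. H z + 1 / (2 * t) * (norm (x - z))\<^sup>2) (\<lambda>_. True) y}"

text \<open>The function \<open>\<phi>\<close> of the growth condition; the supremum may be infinite, and the supremum of
  the empty set is \<open>0\<close>.\<close>

definition subgradient_growth ::
    "('a::real_inner \<Rightarrow> real) \<Rightarrow> real \<Rightarrow> real \<Rightarrow> ennreal" where
  "subgradient_growth G t_max s =
     Sup {ennreal (norm p) | p x t y.
       norm x \<le> s \<and> 0 < t \<and> t \<le> t_max \<and> y \<in> prox G t x \<and> p \<in> regular_subdifferential G y}"

definition diffusion_potential ::
    "(real ^ 'd \<Rightarrow> real) \<Rightarrow> real \<Rightarrow> real \<Rightarrow> real ^ 'd \<Rightarrow> real" where
  "diffusion_potential G t T x =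
     - T * ln (1 / (2 * pi * T * t) powr (real CARD('d) / 2) *
        (\<integral>y. exp (- G y / T - 1 / (2 * T * t) * (norm (x - y))\<^sup>2) \<partial>lborel))"

end

theory Submission
  imports Defs "HOL-Probability.Distributions"
begin

text \<open>Differentiating under the integral gives \<open>\<nabla>G\<^sub>T\<^sup>t(x) = (x - m\<^sub>T(x)) / t\<close>, where \<open>m\<^sub>T(x)\<close> is
  the mean of the Gibbs measure with density proportional to
  \<open>exp (- (G(y) + \<parallel>x - y\<parallel>\<^sup>2 / (2t)) / T)\<close>. Where the envelope is differentiable, the minimiser
  \<open>y\<close> of the energy is unique and \<open>\<nabla>M(x) = (x - y) / t\<close>. By Laplace's method the Gibbs
  measures concentrate at \<open>y\<close> as \<open>T \<rightarrow> 0\<close>, locally uniformly in the base point, which gives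
  uniform convergence on compact sets.\<close>

text \<open>Two obstacles shape the argument. For large \<open>t\<close> no continuity of the
  minimiser in the base point is known beforehand, and moving the base point changes the energy by
  an amount that is unbounded in the integration variable. The energies at two base points are
  therefore compared up to a factor \<open>1 - d\<close> rather than up to a constant, and the
  concentration estimate lets temperature and base point vary together. Continuity of the minimiser,
  where it is unique, is then a by-product of letting \<open>T\<close> tend to 0. Weak convexity
  enters through continuity of \<open>G\<close> and, for \<open>t < 1 / \<rho>\<close>, through
  strong convexity of the energy, which makes the envelope differentiable.\<close>

section \<open>Gaussian integrability\<close>

lemma integrable_gaussian_real:
  assumes "0 < (b::real)"
  shows "integrable lborel (\<lambda>x::real. exp (- b * x\<^sup>2))"
proof -
  define s where "s = sqrt (1 / (2 * b))"
  have s: "s\<^sup>2 = 1 / (2 * b)" and "0 < s"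
    using assms by (simp_all add: s_def)
  have "integrable lborel (\<lambda>x. sqrt (2 * pi * s\<^sup>2) * normal_density 0 s x)"
    using \<open>0 < s\<close> by (intro integrable_mult_right integrable_normal_density)
  moreover have "sqrt (2 * pi * s\<^sup>2) * normal_density 0 s x = exp (- b * x\<^sup>2)" for x
    using s \<open>0 < s\<close> assms by (simp add: normal_density_def)
  ultimately show ?thesis by simp
qed

lemma integrable_gaussian:
  assumes "0 < (b::real)"
  shows "integrable lborel (\<lambda>x::'a::euclidean_space. exp (- b * (norm x)\<^sup>2))"
proof (rule integrableI_nonneg)
  have prod: "exp (- b * (norm x)\<^sup>2) = (\<Prod>i\<in>Basis. exp (- b * (x \<bullet> i)\<^sup>2))" for x :: 'a
    unfolding power2_norm_eq_inner euclidean_inner[of x x] sum_distrib_left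
    by (subst exp_sum) (simp_all add: power2_eq_square)
  have "(\<integral>\<^sup>+(x::'a). ennreal (exp (- b * (norm x)\<^sup>2)) \<partial>lborel)
      = (\<integral>\<^sup>+(x::'a). (\<Prod>i\<in>Basis. ennreal (exp (- b * (x \<bullet> i)\<^sup>2))) \<partial>lborel)"
    unfolding prod by (simp add: prod_ennreal)
  also have "\<dots> = (\<Prod>i\<in>(Basis::'a set). (\<integral>\<^sup>+x. ennreal (exp (- b * x\<^sup>2)) \<partial>lborel))"
    by (rule nn_integral_lborel_prod[of "\<lambda>i x. ennreal (exp (- b * x\<^sup>2))"]) auto
  also have "\<dots> = (\<Prod>i\<in>(Basis::'a set). ennreal (\<integral>x. exp (- b * x\<^sup>2) \<partial>lborel))"
    by (subst nn_integral_eq_integral[OF integrable_gaussian_real[OF assms]]) auto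
  also have "\<dots> < \<infinity>"
    by (simp add: ennreal_power less_top)
  finally show "(\<integral>\<^sup>+(x::'a). ennreal (exp (- b * (norm x)\<^sup>2)) \<partial>lborel) < \<infinity>" .
qed auto

text \<open>Completing the square lets half of the Gaussian rate absorb the linear term: c s - b s^2
  is at most c^2 / (2 b) - (b / 2) s^2. Linear terms arise from \<open>exp (x \<bullet> y)\<close>
  and from powers of \<open>norm y\<close> bounded by exponentials.\<close>

lemma integrable_gaussian_bound:
  fixes f :: "'a::euclidean_space \<Rightarrow> 'b::{banach, second_countable_topology}"
  assumes "f \<in> borel_measurable borel" "0 < b"
    and bound: "\<And>y. norm (f y) \<le> A * exp (c * norm y - b * (norm y)\<^sup>2)"
  shows "integrable lborel f"
proof (rule Bochner_Integration.integrable_bound)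
  show "integrable lborel (\<lambda>y::'a. \<bar>A\<bar> * exp (c\<^sup>2 / (2 * b)) * exp (- (b / 2) * (norm y)\<^sup>2))"
    using assms by (intro integrable_mult_right integrable_gaussian) simp
  have "norm (f y) \<le> \<bar>A\<bar> * (exp (c\<^sup>2 / (2 * b)) * exp (- (b / 2) * (norm y)\<^sup>2))" for y
  proof -
    have "0 \<le> (b * norm y - c)\<^sup>2 / (2 * b)"
      using assms by simp
    also have "\<dots> = b / 2 * (norm y)\<^sup>2 - c * norm y + c\<^sup>2 / (2 * b)"
      using assms by (simp add: field_simps power2_eq_square)
    finally have "c * norm y - b * (norm y)\<^sup>2 \<le> c\<^sup>2 / (2 * b) + - (b / 2) * (norm y)\<^sup>2"
      by (simp add: field_simps)
    then have "exp (c * norm y - b * (norm y)\<^sup>2)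
        \<le> exp (c\<^sup>2 / (2 * b)) * exp (- (b / 2) * (norm y)\<^sup>2)"
      unfolding exp_add[symmetric] by simp
    then have "\<bar>A\<bar> * exp (c * norm y - b * (norm y)\<^sup>2)
        \<le> \<bar>A\<bar> * (exp (c\<^sup>2 / (2 * b)) * exp (- (b / 2) * (norm y)\<^sup>2))"
      by (intro mult_left_mono) auto
    moreover have "A * exp (c * norm y - b * (norm y)\<^sup>2) \<le> \<bar>A\<bar> * exp (c * norm y - b * (norm y)\<^sup>2)"
      by (intro mult_right_mono) auto
    ultimately show ?thesis using bound[of y] by linarith
  qed
  then show "AE y in lborel. norm (f y)
      \<le> norm (\<bar>A\<bar> * exp (c\<^sup>2 / (2 * b)) * exp (- (b / 2) * (norm y)\<^sup>2))"
    by (simp add: abs_mult mult.assoc)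
qed (use assms in auto)

section \<open>Differentiating a Laplace transform under the integral sign\<close>

lemma exp_remainder_bound:
  "\<bar>exp u - 1 - u\<bar> \<le> u\<^sup>2 * exp \<bar>u\<bar>" for u :: real
proof -
  have "exp u * (1 - u) \<le> exp u * exp (- u)"
    using exp_ge_add_one_self[of "- u"] by (intro mult_left_mono) auto
  then have "exp u - 1 - u \<le> u * (exp u - 1)"
    by (simp add: exp_minus algebra_simps)
  also have "\<dots> \<le> \<bar>u\<bar> * (\<bar>u\<bar> * exp \<bar>u\<bar>)"
  proof (cases "0 \<le> u")
    case True
    then show ?thesis
      using \<open>exp u * (1 - u) \<le> exp u * exp (- u)\<close>
      by (intro mult_mono) (auto simp: exp_minus algebra_simps)
  next
    case False
    have "\<bar>u\<bar> * (1 - exp u) \<le> \<bar>u\<bar> * (\<bar>u\<bar> * exp \<bar>u\<bar>)"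
    proof (rule mult_left_mono)
      have "1 - exp u \<le> \<bar>u\<bar> * 1"
        using exp_ge_add_one_self[of u] False by linarith
      also have "\<dots> \<le> \<bar>u\<bar> * exp \<bar>u\<bar>"
        by (intro mult_left_mono) auto
      finally show "1 - exp u \<le> \<bar>u\<bar> * exp \<bar>u\<bar>" .
    qed simp
    then show ?thesis using False by (simp add: algebra_simps)
  qed
  also have "\<bar>u\<bar> * (\<bar>u\<bar> * exp \<bar>u\<bar>) = u\<^sup>2 * exp \<bar>u\<bar>"
    by (simp add: power2_eq_square flip: mult.assoc)
  finally show ?thesis
    using exp_ge_add_one_self[of u] by linarith
qed

lemma norm_le_exp_norm: "norm y \<le> exp (norm y)" for y :: "'a::real_normed_vector"
  using exp_ge_add_one_self[of "norm y"] by linarith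

context
  fixes w :: "'a::euclidean_space \<Rightarrow> real" and b :: real
  assumes w_measurable [measurable]: "w \<in> borel_measurable borel"
    and b_pos: "0 < b"
    and w_nonneg: "\<And>y. 0 \<le> w y"
    and w_le: "\<And>y. w y \<le> exp (- b * (norm y)\<^sup>2)"
begin

lemma exp_inner_weight_le: "exp (x \<bullet> y) * w y \<le> exp (norm x * norm y - b * (norm y)\<^sup>2)"
proof -
  have "exp (x \<bullet> y) * w y \<le> exp (norm x * norm y) * exp (- b * (norm y)\<^sup>2)"
    by (intro mult_mono w_le w_nonneg) (auto simp: norm_cauchy_schwarz)
  then show ?thesis by (simp add: exp_diff exp_minus field_simps)
qed

lemma integrable_exp_inner:
  "integrable lborel (\<lambda>y. exp (x \<bullet> y) * w y)"
  by (rule integrable_gaussian_bound[OF _ b_pos, where A = 1 and c = "norm x"])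
     (use exp_inner_weight_le w_nonneg in auto)

lemma integrable_exp_inner_scaleR:
  "integrable lborel (\<lambda>y. (exp (x \<bullet> y) * w y) *\<^sub>R y)"
proof (rule integrable_gaussian_bound[OF _ b_pos, where A = 1 and c = "norm x + 1"])
  fix y
  have "(exp (x \<bullet> y) * w y) * norm y \<le> exp (norm x * norm y - b * (norm y)\<^sup>2) * exp (norm y)"
    by (intro mult_mono exp_inner_weight_le norm_le_exp_norm) auto
  then show "norm ((exp (x \<bullet> y) * w y) *\<^sub>R y)
      \<le> 1 * exp ((norm x + 1) * norm y - b * (norm y)\<^sup>2)"
    by (simp add: w_nonneg exp_add[symmetric] algebra_simps)
qed auto

text \<open>The first-order Taylor remainder of the integrand is at most
  \<open>(norm (z - x))\<^sup>2 * R y\<close> with \<open>R\<close> integrable, so after integration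
  the difference quotient has an error linear in \<open>norm (z - x)\<close>.\<close>

lemma has_derivative_laplace_transform:
  "((\<lambda>x. \<integral>y. exp (x \<bullet> y) * w y \<partial>lborel) has_derivative
    (\<lambda>h. h \<bullet> (\<integral>y. (exp (x \<bullet> y) * w y) *\<^sub>R y \<partial>lborel))) (at x)"
proof -
  \<comment> \<open>With u = \<open>(z - x) \<bullet> y\<close>, the remainder is at most u^2 exp
    |u|. For \<open>dist z x < 1\<close>, Cauchy-Schwarz bounds exp |u| by
    \<open>exp (norm y)\<close>, and u^2 leaves the factor \<open>(norm y)\<^sup>2\<close>.\<close>
  define R where "R = (\<lambda>y. exp (x \<bullet> y) * w y * ((norm y)\<^sup>2 * exp (norm y)))"
  have int_R: "integrable lborel R"
  proof (rule integrable_gaussian_bound[OF _ b_pos, where A = 2 and c = "norm x + 2"])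
    show "R \<in> borel_measurable borel" unfolding R_def by measurable
    fix y :: 'a
    have "(norm y)\<^sup>2 \<le> 2 * exp (norm y)"
      using exp_lower_Taylor_quadratic[of "norm y"] norm_ge_zero[of y] by linarith
    then have "(norm y)\<^sup>2 * exp (norm y) \<le> (2 * exp (norm y)) * exp (norm y)"
      by (intro mult_right_mono) auto
    then have "R y \<le> exp (norm x * norm y - b * (norm y)\<^sup>2) * (2 * exp (norm y) * exp (norm y))"
      unfolding R_def using w_nonneg by (intro mult_mono exp_inner_weight_le) auto
    also have "\<dots> = 2 * exp ((norm x + 2) * norm y - b * (norm y)\<^sup>2)"
      by (simp add: exp_add[symmetric] algebra_simps)
    finally show "norm (R y) \<le> 2 * exp ((norm x + 2) * norm y - b * (norm y)\<^sup>2)"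
      using w_nonneg[of y] by (simp add: R_def)
  qed
  let ?L = "\<lambda>x. \<integral>y. exp (x \<bullet> y) * w y \<partial>lborel"
  let ?D = "\<integral>y. (exp (x \<bullet> y) * w y) *\<^sub>R y \<partial>lborel"
  have bound: "\<bar>?L z - ?L x - (z - x) \<bullet> ?D\<bar> \<le> (norm (z - x))\<^sup>2 * integral\<^sup>L lborel R"
    if "dist z x < 1" for z
  proof -
    have eq: "?L z - ?L x - (z - x) \<bullet> ?D
        = (\<integral>y. exp (z \<bullet> y) * w y - exp (x \<bullet> y) * w y
             - (z - x) \<bullet> ((exp (x \<bullet> y) * w y) *\<^sub>R y) \<partial>lborel)"
      using integrable_exp_inner integrable_exp_inner_scaleR[of x]
      by (simp del: inner_scaleR_right)
    have int: "integrable lborel (\<lambda>y. exp (z \<bullet> y) * w y - exp (x \<bullet> y) * w y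
             - (z - x) \<bullet> ((exp (x \<bullet> y) * w y) *\<^sub>R y))"
      using integrable_exp_inner integrable_exp_inner_scaleR[of x]
      by (intro Bochner_Integration.integrable_diff integrable_inner_right) auto
    have pw: "norm (exp (z \<bullet> y) * w y - exp (x \<bullet> y) * w y
             - (z - x) \<bullet> ((exp (x \<bullet> y) * w y) *\<^sub>R y)) \<le> (norm (z - x))\<^sup>2 * R y" for y
    proof -
      define u where "u = (z - x) \<bullet> y"
      have "exp (z \<bullet> y) * w y - exp (x \<bullet> y) * w y - (z - x) \<bullet> ((exp (x \<bullet> y) * w y) *\<^sub>R y)
          = (exp (x \<bullet> y) * w y) * (exp u - 1 - u)"
        by (simp add: u_def inner_diff_left exp_diff algebra_simps)
      then have "norm (exp (z \<bullet> y) * w y - exp (x \<bullet> y) * w y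
             - (z - x) \<bullet> ((exp (x \<bullet> y) * w y) *\<^sub>R y))
          = (exp (x \<bullet> y) * w y) * \<bar>exp u - 1 - u\<bar>"
        using w_nonneg by (simp add: abs_mult)
      also have "\<dots> \<le> (exp (x \<bullet> y) * w y) * (u\<^sup>2 * exp \<bar>u\<bar>)"
        using w_nonneg by (intro mult_left_mono exp_remainder_bound) auto
      also have "\<dots> \<le> (exp (x \<bullet> y) * w y) * ((norm (z - x) * norm y)\<^sup>2 * exp (norm y))"
      proof (intro mult_left_mono mult_mono)
        have u: "\<bar>u\<bar> \<le> norm (z - x) * norm y"
          unfolding u_def by (rule Cauchy_Schwarz_ineq2)
        then show "u\<^sup>2 \<le> (norm (z - x) * norm y)\<^sup>2"
          by (metis abs_ge_zero power2_abs power_mono)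
        have "norm (z - x) * norm y \<le> 1 * norm y"
          using that by (intro mult_right_mono) (auto simp: dist_norm)
        then show "exp \<bar>u\<bar> \<le> exp (norm y)" using u by simp
      qed (use w_nonneg in auto)
      finally show ?thesis by (simp add: R_def power_mult_distrib mult_ac)
    qed
    have "norm (\<integral>y. exp (z \<bullet> y) * w y - exp (x \<bullet> y) * w y
             - (z - x) \<bullet> ((exp (x \<bullet> y) * w y) *\<^sub>R y) \<partial>lborel)
        \<le> (\<integral>y. (norm (z - x))\<^sup>2 * R y \<partial>lborel)"
      by (rule Bochner_Integration.integral_norm_bound_integral[OF int _ pw])
         (use int_R in auto)
    then show ?thesis unfolding eq by simp
  qed
  show ?thesis
  proof (rule has_derivativeI_sandwich[where e = 1
        and H = "\<lambda>z. norm (z - x) * integral\<^sup>L lborel R"])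
    show "bounded_linear (\<lambda>h. h \<bullet> ?D)"
      by (rule bounded_linear_inner_left)
    show "((\<lambda>z. norm (z - x) * integral\<^sup>L lborel R) \<longlongrightarrow> 0) (at x)"
      by (auto intro!: tendsto_eq_intros)
    fix z assume z: "z \<noteq> x" "dist z x < 1"
    show "norm (?L z - ?L x - (z - x) \<bullet> ?D) / norm (z - x) \<le> norm (z - x) * integral\<^sup>L lborel R"
      using bound[OF z(2)] z(1) by (simp add: field_simps power2_eq_square)
  qed auto
qed

end

section \<open>Gradients, minima of coercive functions, and the proximal energy\<close>

lemma gradient_eqI:
  assumes "GDERIV f x :> D"
  shows "gradient f x = D"
  unfolding gradient_def
proof (rule the_equality)
  fix D' assume "GDERIV f x :> D'"
  with assms have "(\<lambda>h. h \<bullet> D') = (\<lambda>h. h \<bullet> D)"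
    unfolding gderiv_def by (rule has_derivative_unique[rotated])
  then have "(D' - D) \<bullet> D' = (D' - D) \<bullet> D"
    by (rule fun_cong)
  then show "D' = D"
    by (metis eq_iff_diff_eq_0 inner_diff_right inner_eq_zero_iff)
qed fact

text \<open>Beyond the radius \<open>sqrt (f z0 / c)\<close> the quadratic lower bound exceeds the
  value at any chosen \<open>z0\<close> in \<open>C\<close>, so only a compact piece of
  \<open>C\<close> matters. The set is general because the whole space gives minimisers and the
  complement of a ball gives the energy gap.\<close>

lemma coercive_attains_min:
  fixes f :: "'a::euclidean_space \<Rightarrow> real"
  assumes "continuous_on C f" "closed C" "C \<noteq> {}" "0 < c"
    and coercive: "\<And>y. c * (norm (x - y))\<^sup>2 \<le> f y"
  obtains z where "z \<in> C" "\<And>y. y \<in> C \<Longrightarrow> f z \<le> f y"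
proof -
  obtain z0 where z0: "z0 \<in> C" using assms by auto
  define R where "R = sqrt (f z0 / c)"
  have far: "f z0 < f y" if "R < norm (x - y)" for y
  proof -
    have "f z0 / c < (norm (x - y))\<^sup>2"
      using that unfolding R_def by (meson not_le real_le_rsqrt)
    then have "f z0 < c * (norm (x - y))\<^sup>2"
      using \<open>0 < c\<close> by (simp add: field_simps)
    also have "\<dots> \<le> f y" by (rule coercive)
    finally show ?thesis .
  qed
  have "norm (x - z0) \<le> R"
    using far[of z0] by (meson less_irrefl not_le)
  then have "C \<inter> cball x R \<noteq> {}"
    using z0 by (auto simp: dist_norm)
  then obtain z where z: "z \<in> C \<inter> cball x R" "\<And>y. y \<in> C \<inter> cball x R \<Longrightarrow> f z \<le> f y"
    using continuous_attains_inf[of "C \<inter> cball x R" f] assms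
    by (meson closed_Int_compact compact_cball continuous_on_subset inf_le1)
  have "f z \<le> f y" if "y \<in> C" for y
  proof (cases "norm (x - y) \<le> R")
    case True
    then show ?thesis using z(2) that by (auto simp: dist_norm)
  next
    case False
    moreover have "f z \<le> f z0"
      using z(2) z0 \<open>norm (x - z0) \<le> R\<close> by (auto simp: dist_norm)
    ultimately show ?thesis using far[of y] by linarith
  qed
  with z(1) show thesis by (intro that[of z]) auto
qed

definition prox_objective :: "('a::real_normed_vector \<Rightarrow> real) \<Rightarrow> real \<Rightarrow> 'a \<Rightarrow> 'a \<Rightarrow> real" where
  "prox_objective H t x y = H y + 1 / (2 * t) * (norm (x - y))\<^sup>2"

definition gibbs_weight :: "('a::real_normed_vector \<Rightarrow> real) \<Rightarrow> real \<Rightarrow> real \<Rightarrow> 'a \<Rightarrow> 'a \<Rightarrow> real" where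
  "gibbs_weight H t T x y = exp (- prox_objective H t x y / T)"

definition gibbs_mean :: "('a::euclidean_space \<Rightarrow> real) \<Rightarrow> real \<Rightarrow> real \<Rightarrow> 'a \<Rightarrow> 'a" where
  "gibbs_mean H t T x =
     (\<integral>y. gibbs_weight H t T x y *\<^sub>R y \<partial>lborel) /\<^sub>R (\<integral>y. gibbs_weight H t T x y \<partial>lborel)"

lemma moreau_envelope_eq: "moreau_envelope H t x = (INF y. prox_objective H t x y)"
  by (simp add: moreau_envelope_def prox_objective_def)

text \<open>\<open>H\<close> cancels when only the base point moves, which leaves an exact parabola
  with slope \<open>(x - y) /\<^sub>R t\<close>. This is the only source of gradients of the
  envelope.\<close>

lemma prox_objective_diff:
  fixes H :: "'a::real_inner \<Rightarrow> real"
  assumes "t \<noteq> 0"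
  shows "prox_objective H t z y - prox_objective H t x y
    = (z - x) \<bullet> ((x - y) /\<^sub>R t) + (norm (z - x))\<^sup>2 / (2 * t)"
  using assms unfolding prox_objective_def power2_norm_eq_inner
  by (simp add: inner_simps inner_commute field_simps)

section \<open>The Moreau envelope: minimisers and differentiability\<close>

locale moreau_setting =
  fixes G :: "'a::euclidean_space \<Rightarrow> real" and t :: real
  assumes G_nonneg: "\<And>x. 0 \<le> G x"
    and G_cont: "continuous_on UNIV G"
    and t_pos: "0 < t"
begin

abbreviation "obj \<equiv> prox_objective G t"
abbreviation "env \<equiv> moreau_envelope G t"

lemma G_measurable [measurable]: "G \<in> borel_measurable borel"
  by (rule borel_measurable_continuous_onI[OF G_cont])

lemma obj_cont: "continuous_on UNIV (obj x)"
  unfolding prox_objective_def by (intro continuous_intros G_cont)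

lemma obj_measurable [measurable]: "obj x \<in> borel_measurable borel"
  by (rule borel_measurable_continuous_onI[OF obj_cont])

lemma obj_ge: "1 / (2 * t) * (norm (x - y))\<^sup>2 \<le> obj x y"
  using G_nonneg[of y] by (simp add: prox_objective_def)

lemma obj_nonneg: "0 \<le> obj x y"
  using G_nonneg[of y] t_pos by (simp add: prox_objective_def)

lemma env_le: "env x \<le> obj x y"
  unfolding moreau_envelope_eq by (rule cINF_lower) (auto intro!: bdd_belowI2 obj_nonneg)

lemma env_eq_obj:
  assumes "\<And>z. obj x y \<le> obj x z"
  shows "env x = obj x y"
  unfolding moreau_envelope_eq by (rule cInf_eq_minimum) (use assms in auto)

lemma obtain_minimiser:
  obtains y where "\<And>z. obj x y \<le> obj x z"
  using coercive_attains_min[OF obj_cont closed_UNIV, of "1 / (2 * t)"] obj_ge t_pos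
  by (metis UNIV_I UNIV_not_empty zero_less_divide_1_iff zero_less_mult_iff zero_less_numeral)

text \<open>The envelope lies below the smooth function \<open>\<lambda>z. obj z y\<close>, with equality at \<open>x\<close>.\<close>

lemma env_GDERIV:
  assumes diff: "env differentiable (at x)" and min: "\<And>z. obj x y \<le> obj x z"
  shows "GDERIV env x :> (x - y) /\<^sub>R t"
proof -
  obtain E where E: "(env has_derivative E) (at x)"
    using diff by (auto simp: differentiable_def)
  have O: "((\<lambda>z. obj z y) has_derivative (\<lambda>h. h \<bullet> ((x - y) /\<^sub>R t))) (at x)"
  proof -
    have "(\<lambda>z. obj z y)
        = (\<lambda>z. obj x y + (z - x) \<bullet> ((x - y) /\<^sub>R t) + ((z - x) \<bullet> (z - x)) / (2 * t))"
      using prox_objective_diff[of t G _ y x] t_pos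
      by (simp add: power2_norm_eq_inner algebra_simps fun_eq_iff)
    moreover have "((\<lambda>z. obj x y + (z - x) \<bullet> ((x - y) /\<^sub>R t) + ((z - x) \<bullet> (z - x)) / (2 * t))
        has_derivative (\<lambda>h. h \<bullet> ((x - y) /\<^sub>R t))) (at x)"
      using t_pos by (auto intro!: derivative_eq_intros)
    ultimately show ?thesis by simp
  qed
  have "(\<lambda>h. h \<bullet> ((x - y) /\<^sub>R t) - E h) = (\<lambda>h. 0)"
    using env_le env_eq_obj[OF min]
    by (intro has_derivative_local_min[OF has_derivative_diff[OF O E]] always_eventually) simp
  then have "E = (\<lambda>h. h \<bullet> ((x - y) /\<^sub>R t))"
    by (simp add: fun_eq_iff)
  then show ?thesis using E by (simp add: gderiv_def)
qed

text \<open>The gradient of the envelope equals \<open>(x - y) /\<^sub>R t\<close> for every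
  minimiser \<open>y\<close>, so it determines \<open>y\<close>.\<close>

lemma minimiser_unique:
  assumes diff: "env differentiable (at x)" and min: "\<And>z. obj x y \<le> obj x z"
    and "z \<noteq> y"
  shows "obj x y < obj x z"
proof (rule ccontr)
  assume "\<not> obj x y < obj x z"
  then have "\<And>z'. obj x z \<le> obj x z'"
    using min by (meson linorder_not_less order_trans)
  then have "gradient env x = (x - z) /\<^sub>R t"
    by (intro gradient_eqI env_GDERIV diff)
  moreover have "gradient env x = (x - y) /\<^sub>R t"
    by (intro gradient_eqI env_GDERIV diff min)
  ultimately show False
    using \<open>z \<noteq> y\<close> t_pos by simp
qed

text \<open>The quadratic term contributes 1 / t of convexity and weak convexity costs
  \<open>\<rho>\<close>, so \<open>obj x\<close> is strongly convex with modulus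
  \<open>\<mu>\<close>. Hence minimisers are Lipschitz in the base point, and the increment of the
  envelope is squeezed between increments of two parabolas whose slopes at \<open>x\<close> differ
  by O(\<open>norm (x' - x)\<close>).\<close>

lemma env_differentiable:
  assumes "t < 1 / \<rho>" "0 < \<rho>" and wc: "convex_on UNIV (\<lambda>x. G x + \<rho> / 2 * (norm x)\<^sup>2)"
  shows "env differentiable (at x)"
proof -
  define \<mu> where "\<mu> = 1 / t - \<rho>"
  have "0 < \<mu>"
    using assms t_pos by (simp add: \<mu>_def field_simps)
  \<comment> \<open>Comparing the minimum with the value at the midpoint \<open>m\<close> gives
    \<open>\<mu> / 4\<close>, half of the optimal constant, which suffices.\<close>
  have growth: "obj x y + \<mu> / 4 * (norm (z - y))\<^sup>2 \<le> obj x z"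
    if min: "\<And>z. obj x y \<le> obj x z" for x y z
  proof -
    define m where "m = (1 / 2) *\<^sub>R y + (1 / 2) *\<^sub>R z"
    have m: "(norm (w - m))\<^sup>2
        = (norm (w - y))\<^sup>2 / 2 + (norm (w - z))\<^sup>2 / 2 - (norm (z - y))\<^sup>2 / 4" for w
      unfolding m_def power2_norm_eq_inner by (simp add: inner_simps inner_commute field_simps)
    have "G m + \<rho> / 2 * (norm m)\<^sup>2
        \<le> 1 / 2 * (G y + \<rho> / 2 * (norm y)\<^sup>2) + 1 / 2 * (G z + \<rho> / 2 * (norm z)\<^sup>2)"
      using convex_onD[OF wc, of "1 / 2" y z] by (simp add: m_def)
    moreover have "\<rho> / 2 * (norm m)\<^sup>2
        = \<rho> / 2 * ((norm y)\<^sup>2 / 2 + (norm z)\<^sup>2 / 2 - (norm (z - y))\<^sup>2 / 4)"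
      using m[of 0] by simp
    ultimately have "G m \<le> G y / 2 + G z / 2 + \<rho> / 8 * (norm (z - y))\<^sup>2"
      by (simp add: algebra_simps)
    then have "obj x m \<le> obj x y / 2 + obj x z / 2 - \<mu> / 8 * (norm (z - y))\<^sup>2"
      unfolding prox_objective_def m \<mu>_def
      by (simp add: algebra_simps add_divide_distrib diff_divide_distrib)
    with min[of m] show ?thesis by (simp add: field_simps)
  qed
  obtain y where y: "\<And>z. obj x y \<le> obj x z"
    using obtain_minimiser[of x] by blast
  let ?g = "(x - y) /\<^sub>R t"
  \<comment> \<open>Quadratic growth at both minimisers is added. In the resulting second difference
    of \<open>obj\<close> everything cancels except a term bilinear in \<open>x' - x\<close> and
    \<open>y' - y\<close>; one factor \<open>norm (y' - y)\<close> is then divided out.\<close>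
  have lip: "norm (y' - y) \<le> 2 / (\<mu> * t) * norm (x' - x)"
    if min: "\<And>z. obj x' y' \<le> obj x' z" for x' y'
  proof -
    have "\<mu> / 2 * (norm (y' - y))\<^sup>2
        \<le> (obj x' y - obj x y) - (obj x' y' - obj x y')"
      using growth[OF y, of y'] growth[OF min, of y] by (simp add: norm_minus_commute)
    also have "\<dots> = (x' - x) \<bullet> ((y' - y) /\<^sub>R t)"
      using t_pos by (simp add: prox_objective_diff inner_diff_right right_diff_distrib)
    also have "\<dots> \<le> norm (x' - x) * norm ((y' - y) /\<^sub>R t)"
      by (rule norm_cauchy_schwarz)
    also have "norm ((y' - y) /\<^sub>R t) = norm (y' - y) / t"
      using t_pos by (simp only: norm_scaleR) (simp add: divide_inverse_commute)
    finally have "norm (y' - y) * (\<mu> / 2 * norm (y' - y))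
        \<le> norm (y' - y) * (norm (x' - x) / t)"
      using t_pos by (simp add: power2_eq_square field_simps)
    then have "\<mu> / 2 * norm (y' - y) \<le> norm (x' - x) / t"
      using t_pos by (cases "y' = y") (simp, meson mult_left_le_imp_le right_minus_eq zero_less_norm_iff)
    then show ?thesis
      using \<open>0 < \<mu>\<close> t_pos by (simp add: field_simps)
  qed
  \<comment> \<open>The first summand is the curvature of the parabola. The second is the Lipschitz
    constant of the minimiser divided by \<open>t\<close>, the cost of replacing \<open>y'\<close>
    by \<open>y\<close> in the slope.\<close>
  define C where "C = 1 / (2 * t) + 2 / (\<mu> * t) / t"
  have "(env has_derivative (\<lambda>h. h \<bullet> ?g)) (at x)"
  proof (rule has_derivativeI_sandwich[where e = 1 and H = "\<lambda>x'. C * norm (x' - x)"])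
    show "bounded_linear (\<lambda>h. h \<bullet> ?g)"
      by (rule bounded_linear_inner_left)
    show "((\<lambda>x'. C * norm (x' - x)) \<longlongrightarrow> 0) (at x)"
      by (auto intro!: tendsto_eq_intros)
    fix x' assume "x' \<noteq> x"
    obtain y' where y': "\<And>z. obj x' y' \<le> obj x' z"
      using obtain_minimiser[of x'] by blast
    let ?d = "norm (x' - x)"
    \<comment> \<open>The upper bound tests the envelope at \<open>x'\<close> with the minimiser for
      \<open>x\<close>; the lower bound tests it at \<open>x\<close> with the minimiser for
      \<open>x'\<close>.\<close>
    have "env x' - env x \<le> obj x' y - obj x y"
      using env_le[of x' y] env_eq_obj[OF y] by simp
    then have upper: "env x' - env x - (x' - x) \<bullet> ?g \<le> ?d\<^sup>2 / (2 * t)"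
      using prox_objective_diff[of t G x' y x] t_pos by simp
    have "obj x' y' - obj x y' \<le> env x' - env x"
      using env_le[of x y'] env_eq_obj[OF y'] by simp
    moreover have "obj x' y' - obj x y' - (x' - x) \<bullet> ?g
        = ?d\<^sup>2 / (2 * t) - (x' - x) \<bullet> ((y' - y) /\<^sub>R t)"
      using t_pos by (simp add: prox_objective_diff inner_simps algebra_simps)
    moreover have "(x' - x) \<bullet> ((y' - y) /\<^sub>R t) \<le> ?d * (2 / (\<mu> * t) * ?d / t)"
    proof -
      have "(x' - x) \<bullet> ((y' - y) /\<^sub>R t) \<le> ?d * norm ((y' - y) /\<^sub>R t)"
        by (rule norm_cauchy_schwarz)
      also have "\<dots> = ?d * (norm (y' - y) / t)"
        using t_pos by (simp only: norm_scaleR) (simp add: divide_inverse_commute)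
      also have "\<dots> \<le> ?d * (2 / (\<mu> * t) * ?d / t)"
        using t_pos by (intro mult_left_mono divide_right_mono lip y') auto
      finally show ?thesis .
    qed
    moreover have "0 \<le> ?d\<^sup>2 / (2 * t)" "0 \<le> ?d * (2 / (\<mu> * t) * ?d / t)"
      using t_pos \<open>0 < \<mu>\<close> by auto
    moreover have "C * ?d * ?d = ?d\<^sup>2 / (2 * t) + ?d * (2 / (\<mu> * t) * ?d / t)"
      by (simp add: C_def power2_eq_square algebra_simps)
    ultimately have "\<bar>env x' - env x - (x' - x) \<bullet> ?g\<bar> \<le> C * ?d * ?d"
      using upper by linarith
    then show "norm (env x' - env x - (x' - x) \<bullet> ?g) / ?d \<le> C * ?d"
      using \<open>x' \<noteq> x\<close> by (simp add: pos_divide_le_eq)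
  qed auto
  then show ?thesis
    by (rule differentiableI)
qed

section \<open>Gibbs weights and the gradient of the free energy\<close>

abbreviation "weight \<equiv> gibbs_weight G t"

text \<open>Expanding the square turns the partition function into a Gaussian factor times a Laplace
  transform.\<close>

definition laplace_weight :: "real \<Rightarrow> 'a \<Rightarrow> real" where
  "laplace_weight T y = exp (- G y / T - (norm y)\<^sup>2 / (2 * T * t))"

lemma laplace_weight_measurable [measurable]: "laplace_weight T \<in> borel_measurable borel"
  unfolding laplace_weight_def by measurable

lemma laplace_weight_nonneg: "0 \<le> laplace_weight T y"
  by (simp add: laplace_weight_def)

lemma laplace_weight_le:
  "0 < T \<Longrightarrow> laplace_weight T y \<le> exp (- (1 / (2 * T * t)) * (norm y)\<^sup>2)"
  using G_nonneg[of y] by (simp add: laplace_weight_def)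

lemma weight_eq:
  assumes "0 < T"
  shows "weight T x y = exp (- (norm x)\<^sup>2 / (2 * T * t))
    * (exp ((x /\<^sub>R (T * t)) \<bullet> y) * laplace_weight T y)"
proof -
  have "- obj x y / T = - (norm x)\<^sup>2 / (2 * T * t)
      + (((x /\<^sub>R (T * t)) \<bullet> y) + (- G y / T - (norm y)\<^sup>2 / (2 * T * t)))"
    using assms t_pos unfolding prox_objective_def power2_norm_eq_inner
    by (simp add: inner_simps inner_commute field_simps)
  then show ?thesis
    by (simp only: gibbs_weight_def laplace_weight_def exp_add)
qed

lemma weight_pos: "0 < weight T x y"
  by (simp add: gibbs_weight_def)

lemma weight_measurable [measurable]: "weight T x \<in> borel_measurable borel"
  unfolding gibbs_weight_def by measurable

lemma gaussian_rate_pos: "0 < T \<Longrightarrow> 0 < 1 / (2 * T * t)"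
  using t_pos by simp

lemmas laplace_facts = laplace_weight_measurable gaussian_rate_pos laplace_weight_nonneg
  laplace_weight_le

lemma integrable_weight: "0 < T \<Longrightarrow> integrable lborel (\<lambda>y. weight T x y)"
  by (subst weight_eq, assumption) (intro integrable_mult_right integrable_exp_inner[OF laplace_facts])

lemma integrable_weight_scaleR: "0 < T \<Longrightarrow> integrable lborel (\<lambda>y. weight T x y *\<^sub>R y)"
  by (simp only: weight_eq scaleR_scaleR[symmetric, of "exp (- (norm x)\<^sup>2 / (2 * T * t))"])
     (intro integrable_scaleR_right integrable_exp_inner_scaleR[OF laplace_facts])

text \<open>Bounds the denominator of the Gibbs mean from below in Laplace's method.\<close>

lemma partition_ge_ball:
  assumes "0 < T" "\<And>y. y \<in> ball y0 r \<Longrightarrow> c \<le> weight T x y"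
  shows "c * measure lborel (ball y0 r) \<le> (\<integral>y. weight T x y \<partial>lborel)"
proof -
  have fin: "emeasure lborel (ball y0 r) < \<infinity>"
    by (rule emeasure_lborel_ball_finite)
  have "(\<integral>y. c * indicator (ball y0 r) y \<partial>lborel) \<le> (\<integral>y. weight T x y \<partial>lborel)"
  proof (rule integral_mono)
    show "integrable lborel (\<lambda>y. c * indicator (ball y0 r) y)"
      using fin by (intro integrable_mult_right integrable_real_indicator) auto
    fix y show "c * indicator (ball y0 r) y \<le> weight T x y"
      using assms(2)[of y] weight_pos[of T x y] by (auto simp: indicator_def)
  qed (rule integrable_weight[OF assms(1)])
  then show ?thesis by simp
qed

lemma partition_pos:
  assumes "0 < T"
  shows "0 < (\<integral>y. weight T x y \<partial>lborel)"
proof -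
  have "0 \<le> (\<integral>y. weight T x y \<partial>lborel)"
    by (intro integral_nonneg_AE) (simp add: weight_pos less_imp_le)
  moreover have "(\<integral>y. weight T x y \<partial>lborel) \<noteq> 0"
  proof
    assume "(\<integral>y. weight T x y \<partial>lborel) = 0"
    then have "AE y in lborel. weight T x y = 0"
      using integrable_weight[OF assms]
      by (subst (asm) integral_nonneg_eq_0_iff_AE) (auto simp: weight_pos less_imp_le)
    then have "AE y::'a in lborel. False"
      using weight_pos by (simp add: less_le)
    then show False by (simp add: AE_iff_measurable[OF _ refl])
  qed
  ultimately show ?thesis by simp
qed

text \<open>With s = 1 / (T t), the function is a constant plus |x|^2 / (2 t) - T ln L(s x). The
  chain rule gives x / t - T s m(s x) / L(s x), where T s = 1 / t and m / L is the Gibbs mean, since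
  the Gaussian prefactors cancel in the quotient. The constant \<open>c\<close> stands for the
  normalisation and affects only the additive constant.\<close>

lemma free_energy_GDERIV:
  assumes T: "0 < T" and "0 < c"
  shows "GDERIV (\<lambda>x. - T * ln (c * (\<integral>y. weight T x y \<partial>lborel))) x
    :> (x - gibbs_mean G t T x) /\<^sub>R t"
proof -
  define L where "L = (\<lambda>u. \<integral>y. exp (u \<bullet> y) * laplace_weight T y \<partial>lborel)"
  define m where "m = (\<lambda>u. \<integral>y. (exp (u \<bullet> y) * laplace_weight T y) *\<^sub>R y \<partial>lborel)"
  define s where "s = inverse (T * t)"
  have s: "0 < s" using T t_pos by (simp add: s_def)
  have Z: "(\<integral>y. weight T x y \<partial>lborel) = exp (- (norm x)\<^sup>2 / (2 * T * t)) * L (s *\<^sub>R x)" for x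
    by (simp only: weight_eq[OF T] L_def s_def integral_mult_right_zero)
  have Zm: "(\<integral>y. weight T x y *\<^sub>R y \<partial>lborel)
      = exp (- (norm x)\<^sup>2 / (2 * T * t)) *\<^sub>R m (s *\<^sub>R x)" for x
    by (simp only: weight_eq[OF T] m_def s_def integral_scaleR_right
        scaleR_scaleR[symmetric, of "exp (- (norm x)\<^sup>2 / (2 * T * t))"])
  have L_pos: "0 < L (s *\<^sub>R x)" for x
    using partition_pos[OF T, of x] unfolding Z by (simp add: zero_less_mult_iff)
  have mean: "gibbs_mean G t T x = m (s *\<^sub>R x) /\<^sub>R L (s *\<^sub>R x)"
    unfolding gibbs_mean_def Z Zm by simp
  have L_deriv: "(L has_derivative (\<lambda>h. h \<bullet> m u)) (at u)" for u
    unfolding L_def m_def by (rule has_derivative_laplace_transform[OF laplace_facts]) (rule T)+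
  have "((\<lambda>x. L (s *\<^sub>R x)) has_derivative (\<lambda>h. (s *\<^sub>R h) \<bullet> m (s *\<^sub>R x))) (at x)"
    by (rule has_derivative_compose[OF _ L_deriv]) (auto intro!: derivative_eq_intros)
  then have "((\<lambda>x. - T * ln c + (x \<bullet> x) / (2 * t) - T * ln (L (s *\<^sub>R x))) has_derivative
      (\<lambda>h. h \<bullet> ((x - gibbs_mean G t T x) /\<^sub>R t))) (at x)"
    using L_pos[of x] T t_pos unfolding mean
    by (auto intro!: derivative_eq_intros simp: inner_simps inner_commute s_def field_simps)
  moreover have "- T * ln (c * (\<integral>y. weight T x y \<partial>lborel))
      = - T * ln c + (x \<bullet> x) / (2 * t) - T * ln (L (s *\<^sub>R x))" for x
    using L_pos[of x] T t_pos \<open>0 < c\<close> unfolding Z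
    by (simp add: ln_mult power2_norm_eq_inner field_simps)
  ultimately show ?thesis by (simp add: gderiv_def)
qed

section \<open>Concentration of the Gibbs mean at the minimiser\<close>

lemma norm_gibbs_mean_diff_le:
  assumes "0 < T"
  shows "norm (gibbs_mean G t T x - y0)
    \<le> (\<integral>y. weight T x y * norm (y - y0) \<partial>lborel) / (\<integral>y. weight T x y \<partial>lborel)"
proof -
  let ?Z = "\<integral>y. weight T x y \<partial>lborel"
  have Z: "0 < ?Z" by (rule partition_pos[OF assms])
  have "(\<integral>y. weight T x y *\<^sub>R (y - y0) \<partial>lborel)
      = (\<integral>y. weight T x y *\<^sub>R y \<partial>lborel) - ?Z *\<^sub>R y0"
    using integrable_weight[OF assms] integrable_weight_scaleR[OF assms]
    by (simp add: scaleR_diff_right)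
  then have "gibbs_mean G t T x - y0 = (\<integral>y. weight T x y *\<^sub>R (y - y0) \<partial>lborel) /\<^sub>R ?Z"
    using Z by (simp add: gibbs_mean_def scaleR_diff_right)
  then have "norm (gibbs_mean G t T x - y0)
      = norm (\<integral>y. weight T x y *\<^sub>R (y - y0) \<partial>lborel) / ?Z"
    using Z by (simp add: divide_inverse_commute)
  also have "\<dots> \<le> (\<integral>y. norm (weight T x y *\<^sub>R (y - y0)) \<partial>lborel) / ?Z"
    using Z by (intro divide_right_mono integral_norm_bound) auto
  finally show ?thesis
    by (simp add: abs_of_pos weight_pos)
qed

text \<open>Since \<open>G \<ge> 0\<close>, moving the base point costs only a factor close to \<open>1\<close>,
  uniformly in \<open>y\<close>.\<close>

lemma obj_base_change:
  assumes "dist x x0 \<le> d"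
  shows "(1 - d) * obj x0 y - d / (2 * t) \<le> obj x y"
proof -
  let ?n = "norm (x0 - y)"
  have d: "0 \<le> d" using assms by (meson order_trans zero_le_dist)
  have le: "?n - d \<le> norm (x - y)"
    using assms norm_triangle_ineq[of "x0 - x" "x - y"]
    by (simp add: dist_norm norm_minus_commute)
  have "(1 - d) * ?n\<^sup>2 - d \<le> (norm (x - y))\<^sup>2"
  \<comment> \<open>For \<open>d \<le> ?n\<close> the triangle inequality is squared and 2 n is
    bounded by n^2 + 1. Otherwise the left-hand side is not positive.\<close>
  proof (cases "d \<le> ?n")
    case True
    then have "(?n - d)\<^sup>2 \<le> (norm (x - y))\<^sup>2"
      using le by (intro power_mono) auto
    moreover have "(?n - d)\<^sup>2 = ?n\<^sup>2 - d * (2 * ?n) + d\<^sup>2"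
      by (simp add: power2_eq_square algebra_simps)
    moreover have "d * (2 * ?n) \<le> d * (?n\<^sup>2 + 1)"
      using d sum_squares_bound[of ?n 1] by (intro mult_left_mono) auto
    moreover have "0 \<le> d\<^sup>2" by simp
    moreover have "(1 - d) * ?n\<^sup>2 - d = ?n\<^sup>2 - d * (?n\<^sup>2 + 1)"
      by (simp add: algebra_simps)
    ultimately show ?thesis by linarith
  next
    case False
    have "(1 - d) * ?n\<^sup>2 \<le> d"
    proof (cases "d \<le> 1")
      case True
      then have "(1 - d) * ?n\<^sup>2 \<le> 1 * (?n * ?n)"
        using d by (intro mult_mono) (auto simp: power2_eq_square)
      also have "\<dots> \<le> 1 * (d * 1)"
        using False True d by (intro mult_left_mono mult_mono) auto
      finally show ?thesis by simp
    next
      case False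
      then have "(1 - d) * ?n\<^sup>2 \<le> 0"
        by (intro mult_nonpos_nonneg) auto
      then show ?thesis using d by simp
    qed
    then show ?thesis by (smt (verit) zero_le_power2)
  qed
  then have "1 / (2 * t) * ((1 - d) * ?n\<^sup>2 - d) \<le> 1 / (2 * t) * (norm (x - y))\<^sup>2"
    using t_pos by (intro mult_left_mono) auto
  moreover have "(1 - d) * G y \<le> 1 * G y"
    using d G_nonneg[of y] by (intro mult_right_mono) auto
  ultimately show ?thesis
    by (simp add: prox_objective_def algebra_simps diff_divide_distrib)
qed

text \<open>By coercivity the minimum over the complement of the ball is attained, at a point
  different from \<open>y0\<close>, so the strict inequality there is a uniform gap.\<close>

lemma obj_gap:
  assumes min: "\<And>y. y \<noteq> y0 \<Longrightarrow> obj x0 y0 < obj x0 y" and "0 < e"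
  obtains \<eta> where "0 < \<eta>" "\<And>y. e \<le> dist y y0 \<Longrightarrow> obj x0 y0 + \<eta> \<le> obj x0 y"
proof -
  let ?C = "- ball y0 e"
  have "?C \<noteq> {}"
    using not_bounded_UNIV[where 'a = 'a] bounded_ball[of y0 e] by (metis Compl_empty_eq double_complement)
  then obtain z where z: "z \<in> ?C" "\<And>y. y \<in> ?C \<Longrightarrow> obj x0 z \<le> obj x0 y"
    using coercive_attains_min[of ?C "obj x0" "1 / (2 * t)" x0] obj_ge t_pos
      continuous_on_subset[OF obj_cont, of ?C x0]
    by (metis closed_Compl open_ball top_greatest zero_less_divide_1_iff zero_less_mult_iff zero_less_numeral)
  show thesis
  proof (rule that[of "obj x0 z - obj x0 y0"])
    show "0 < obj x0 z - obj x0 y0"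
      using min[of z] z(1) \<open>0 < e\<close> by (cases "z = y0") auto
    show "obj x0 y0 + (obj x0 z - obj x0 y0) \<le> obj x0 y" if "e \<le> dist y y0" for y
      using z(2)[of y] that by (simp add: dist_commute)
  qed
qed

text \<open>Laplace's method, uniformly in the base point: at low temperature the mass outside a ball
  around the minimiser is smaller than the mass near it by the factor \<open>exp (- \<eta> / T)\<close>.\<close>

lemma gibbs_mean_near_minimiser:
  assumes min: "\<And>y. y \<noteq> y0 \<Longrightarrow> obj x0 y0 < obj x0 y" and e: "0 < e"
  obtains \<delta> where "0 < \<delta>"
    "\<And>T x. 0 < T \<Longrightarrow> T < \<delta> \<Longrightarrow> dist x x0 < \<delta> \<Longrightarrow> dist (gibbs_mean G t T x) y0 < e"
proof -
  define M where "M = obj x0 y0"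
  have M: "0 \<le> M" by (simp add: M_def obj_nonneg)
  obtain \<eta>' where \<eta>': "0 < \<eta>'" "\<And>y. e / 2 \<le> dist y y0 \<Longrightarrow> M + \<eta>' \<le> obj x0 y"
    using obj_gap[OF min, of "e / 2"] e unfolding M_def by (metis half_gt_zero)
  \<comment> \<open>The gap is split into four: moving the base point uses up
    \<open>2 * \<eta>\<close>, continuity near \<open>y0\<close> uses \<open>\<eta>\<close>, and the
    last \<open>\<eta>\<close> is the margin behind the factor
    \<open>exp (- \<eta> / T)\<close>.\<close>
  define \<eta> where "\<eta> = \<eta>' / 4"
  have \<eta>: "0 < \<eta>" and gap: "\<And>y. e / 2 \<le> dist y y0 \<Longrightarrow> M + 4 * \<eta> \<le> obj x0 y"
    using \<eta>' by (auto simp: \<eta>_def)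
  have "((\<lambda>z. obj (fst z) (snd z)) \<longlongrightarrow> obj x0 y0) (at (x0, y0))"
  proof -
    have "continuous_on UNIV (\<lambda>z. obj (fst z) (snd z))"
      unfolding prox_objective_def
      by (intro continuous_on_add continuous_on_mult continuous_on_const continuous_on_power
          continuous_on_norm continuous_on_diff continuous_on_fst continuous_on_snd continuous_on_id
          continuous_on_compose2[OF G_cont]) auto
    then have "isCont (\<lambda>z. obj (fst z) (snd z)) (x0, y0)"
      by (simp add: continuous_on_eq_continuous_at)
    then show ?thesis by (simp add: isCont_def)
  qed
  then obtain r' where r': "0 < r'"
    "\<And>z. z \<noteq> (x0, y0) \<Longrightarrow> dist z (x0, y0) < r' \<Longrightarrow> dist (obj (fst z) (snd z)) M < \<eta>"
    using \<eta> unfolding M_def LIM_def by blast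
  define r where "r = r' / 2"
  have r: "0 < r" using r' by (simp add: r_def)
  have near: "obj x y \<le> M + \<eta>" if "dist x x0 < r" "dist y y0 < r" for x y
  proof (cases "(x, y) = (x0, y0)")
    case False
    have "dist (x, y) (x0, y0) \<le> dist x x0 + dist y y0"
      by (simp add: dist_Pair_Pair sqrt_sum_squares_le_sum)
    then show ?thesis
      using r'(2)[OF False] that by (simp add: r_def dist_real_def)
  qed (use \<eta> M_def in auto)
  \<comment> \<open>By \<open>obj_base_change\<close> a shift by \<open>d\<close> turns M + 4
    \<open>\<eta>\<close> into M + 4 \<open>\<eta>\<close> - d S, so
    \<open>d * S \<le> 2 * \<eta>\<close> is what is required. The cap 1 / 2 keeps half of the
    quadratic growth for the majorant \<open>K\<close>.\<close>
  define S where "S = M + 4 * \<eta> + 1 / (2 * t)"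
  define d where "d = min (1 / 2) (2 * \<eta> / S)"
  have "0 < S"
    unfolding S_def using M \<eta> t_pos by (intro add_nonneg_pos add_nonneg_nonneg) auto
  then have "0 < d" "d \<le> 1 / 2" "d \<le> 2 * \<eta> / S"
    using \<eta> by (simp_all add: d_def)
  with \<open>0 < S\<close> have d: "0 < d" "d \<le> 1 / 2" "d * S \<le> 2 * \<eta>"
    by (simp_all only: pos_le_divide_eq)
  have far: "M + 2 * \<eta> \<le> obj x y" if "dist x x0 < d" "e / 2 \<le> dist y y0" for x y
  proof -
    have "(1 - d) * (M + 4 * \<eta>) \<le> (1 - d) * obj x0 y"
      using gap[OF that(2)] d by (intro mult_left_mono) auto
    then show ?thesis
      using obj_base_change[of x x0 d y] that(1) d(3) by (simp add: S_def algebra_simps)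
  qed
  \<comment> \<open>A majorant of the tail independent of \<open>T\<close> and \<open>x\<close>,
    built from the lower bound of \<open>obj x y\<close> that \<open>obj_base_change\<close> gives
    with d = 1 / 2.\<close>
  define K where "K = (\<lambda>y. norm (y - y0)
    * exp (M + 2 * \<eta> + 1 / (4 * t) - (norm (x0 - y))\<^sup>2 / (4 * t)))"
  define C where "C = integral\<^sup>L lborel K"
  have K_nonneg: "0 \<le> K y" for y by (simp add: K_def)
  have int_K: "integrable lborel K"
  proof (rule integrable_gaussian_bound[where b = "1 / (4 * t)" and c = "norm x0 / (2 * t) + 1"
        and A = "exp (norm y0 + M + 2 * \<eta> + 1 / (4 * t))"])
    show "K \<in> borel_measurable borel" unfolding K_def by measurable
    show "0 < 1 / (4 * t)" using t_pos by simp
    fix y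
    have "norm (y - y0) \<le> exp (norm y + norm y0)"
      by (meson exp_le_cancel_iff norm_le_exp_norm norm_triangle_ineq4 order_trans)
    moreover have "(norm y)\<^sup>2 - 2 * norm x0 * norm y \<le> (norm (x0 - y))\<^sup>2"
    proof -
      have "(norm (x0 - y))\<^sup>2 = (norm x0)\<^sup>2 - 2 * (x0 \<bullet> y) + (norm y)\<^sup>2"
        unfolding power2_norm_eq_inner by (simp add: inner_simps inner_commute)
      moreover have "0 \<le> (norm x0)\<^sup>2" by simp
      ultimately show ?thesis
        using norm_cauchy_schwarz[of x0 y] by linarith
    qed
    then have "((norm y)\<^sup>2 - 2 * norm x0 * norm y) / (4 * t) \<le> (norm (x0 - y))\<^sup>2 / (4 * t)"
      using t_pos by (intro divide_right_mono) auto
    ultimately have "K y \<le> exp (norm y + norm y0)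
      * exp (M + 2 * \<eta> + 1 / (4 * t) - ((norm y)\<^sup>2 - 2 * norm x0 * norm y) / (4 * t))"
      unfolding K_def by (intro mult_mono) auto
    also have "\<dots> = exp (norm y0 + M + 2 * \<eta> + 1 / (4 * t))
      * exp ((norm x0 / (2 * t) + 1) * norm y - 1 / (4 * t) * (norm y)\<^sup>2)"
      unfolding exp_add[symmetric] by (simp add: algebra_simps diff_divide_distrib)
    finally show "norm (K y) \<le> \<dots>" using K_nonneg by simp
  qed
  have C: "0 \<le> C" unfolding C_def by (intro integral_nonneg_AE) (simp add: K_nonneg)
  have tail: "weight T x y * norm (y - y0) \<le> K y * exp (- (M + 2 * \<eta>) / T)"
    if T: "0 < T" "T \<le> 1" and x: "dist x x0 < d" and y: "e / 2 \<le> dist y y0" for T x y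
  proof -
    \<comment> \<open>The excess of the energy over M + 2 \<open>\<eta>\<close> is nonnegative far
      from \<open>y0\<close>, so for \<open>T \<le> 1\<close> it only grows on division by
      \<open>T\<close>. The tail at temperature \<open>T\<close> is thus controlled at temperature
      1, up to the factor \<open>exp (- (M + 2 * \<eta>) / T)\<close>.\<close>
    let ?g = "obj x y - (M + 2 * \<eta>)"
    have "?g \<le> ?g / T"
      using far[OF x y] T by (simp add: pos_le_divide_eq mult_left_le)
    moreover have "(norm (x0 - y))\<^sup>2 / (4 * t) - 1 / (4 * t) \<le> obj x y"
    proof -
      have "1 / 2 * ((norm (x0 - y))\<^sup>2 / (2 * t)) \<le> (1 - 1 / 2) * obj x0 y"
        using obj_ge[of x0 y] by simp
      then show ?thesis
        using obj_base_change[of x x0 "1 / 2" y] x d(2) by simp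
    qed
    ultimately have "- obj x y / T
        \<le> (M + 2 * \<eta> + 1 / (4 * t) - (norm (x0 - y))\<^sup>2 / (4 * t)) + (- (M + 2 * \<eta>) / T)"
      unfolding diff_divide_distrib[of "obj x y"] minus_divide_left[symmetric] by linarith
    then have "weight T x y \<le> exp (M + 2 * \<eta> + 1 / (4 * t) - (norm (x0 - y))\<^sup>2 / (4 * t))
        * exp (- (M + 2 * \<eta>) / T)"
      unfolding gibbs_weight_def exp_add[symmetric] by simp
    then have "weight T x y * norm (y - y0)
        \<le> (exp (M + 2 * \<eta> + 1 / (4 * t) - (norm (x0 - y))\<^sup>2 / (4 * t))
        * exp (- (M + 2 * \<eta>) / T)) * norm (y - y0)"
      by (rule mult_right_mono) simp
    then show ?thesis by (simp add: K_def mult_ac)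
  qed
  define V where "V = measure lborel (ball y0 r)"
  have V: "0 < V" using r by (simp add: V_def content_ball_pos)
  \<comment> \<open>The last entry makes \<open>C\<close> smaller than
    \<open>e / 2 * V * (\<eta> / T)\<close>, and \<open>\<eta> / T\<close> is at most
    \<open>exp (\<eta> / T)\<close>. The denominator is \<open>C + 1\<close> because
    \<open>C\<close> may vanish.\<close>
  define \<delta> where "\<delta> = Min {1, d, r, e / 2 * V * \<eta> / (C + 1)}"
  show thesis
  proof (rule that[of \<delta>])
    show "0 < \<delta>" using d r e V \<eta> C by (simp add: \<delta>_def)
    fix T x assume T: "0 < T" "T < \<delta>" and x: "dist x x0 < \<delta>"
    have T': "T \<le> 1" "T < e / 2 * V * \<eta> / (C + 1)" and x': "dist x x0 < d" "dist x x0 < r"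
      using T x by (auto simp: \<delta>_def)
    let ?Z = "\<integral>y. weight T x y \<partial>lborel"
    have Z: "0 < ?Z" by (rule partition_pos[OF T(1)])
    let ?q = "exp (- (M + 2 * \<eta>) / T)"
    have pw: "weight T x y * norm (y - y0) \<le> e / 2 * weight T x y + K y * ?q" for y
    proof (cases "e / 2 \<le> dist y y0")
      case True
      then show ?thesis
        using tail[OF T(1) T'(1) x'(1) True] e weight_pos[of T x y] by (simp add: add_increasing)
    next
      case False
      then have "weight T x y * norm (y - y0) \<le> weight T x y * (e / 2)"
        using weight_pos[of T x y] by (intro mult_left_mono) (auto simp: dist_norm)
      moreover have "0 \<le> K y * ?q" using K_nonneg by simp
      ultimately show ?thesis by (simp add: mult.commute)
    qed
    have "norm (gibbs_mean G t T x - y0) \<le> (\<integral>y. weight T x y * norm (y - y0) \<partial>lborel) / ?Z"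
      by (rule norm_gibbs_mean_diff_le[OF T(1)])
    also have "\<dots> \<le> (\<integral>y. e / 2 * weight T x y + K y * ?q \<partial>lborel) / ?Z"
      using Z integrable_weight[OF T(1)] int_K e weight_pos K_nonneg
      by (intro divide_right_mono integral_mono' pw) (auto intro!: add_nonneg_nonneg simp: less_imp_le)
    also have "\<dots> = (e / 2 * ?Z + C * ?q) / ?Z"
      using integrable_weight[OF T(1)] int_K by (simp add: C_def)
    also have "\<dots> = e / 2 + C * ?q / ?Z"
      using Z by (simp add: field_simps)
    \<comment> \<open>The tail carries \<open>exp (- (M + 2 * \<eta>) / T)\<close>, while the ball
      of radius \<open>r\<close> alone contributes at least
      \<open>exp (- (M + \<eta>) / T) * V\<close> to \<open>?Z\<close>.\<close>
    also have "C * ?q / ?Z < e / 2"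
    proof -
      have "exp (- (M + \<eta>) / T) * V \<le> ?Z"
        unfolding V_def
      proof (rule partition_ge_ball[OF T(1)])
        fix y assume "y \<in> ball y0 r"
        then have "obj x y \<le> M + \<eta>"
          using near x'(2) by (simp add: dist_commute)
        then show "exp (- (M + \<eta>) / T) \<le> weight T x y"
          unfolding gibbs_weight_def exp_le_cancel_iff using T(1) by (intro divide_right_mono) auto
      qed
      moreover have "C * ?q < e / 2 * (exp (- (M + \<eta>) / T) * V)"
      proof -
        have "\<eta> / T \<le> exp (\<eta> / T)"
          using exp_ge_add_one_self[of "\<eta> / T"] by linarith
        moreover have "C < e / 2 * V * (\<eta> / T)"
        proof -
          have "T * (C + 1) < e / 2 * V * \<eta>"
            using T'(2) C by (subst (asm) pos_less_divide_eq) auto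
          then have "C + 1 < e / 2 * V * \<eta> / T"
            using T(1) by (metis mult.commute pos_less_divide_eq)
          then show ?thesis by simp
        qed
        ultimately have "C < e / 2 * V * exp (\<eta> / T)"
          using e V by (smt (verit) mult_left_mono mult_pos_pos half_gt_zero)
        then have "C * ?q < e / 2 * V * exp (\<eta> / T) * ?q"
          by (intro mult_strict_right_mono) auto
        also have "exp (\<eta> / T) * ?q = exp (- (M + \<eta>) / T)"
          unfolding exp_add[symmetric] by (simp add: add_divide_distrib[symmetric])
        then have "e / 2 * V * exp (\<eta> / T) * ?q = e / 2 * (exp (- (M + \<eta>) / T) * V)"
          by (metis mult.assoc mult.commute)
        finally show ?thesis .
      qed
      ultimately have "C * ?q < e / 2 * ?Z"
        using e by (smt (verit) mult_left_mono half_gt_zero)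
      then show ?thesis using Z by (simp add: pos_divide_less_eq)
    qed
    finally show "dist (gibbs_mean G t T x) y0 < e"
      by (simp add: dist_norm)
  qed
qed

section \<open>Pointwise and uniform limits of the Gibbs mean\<close>

lemma gibbs_mean_tendsto:
  assumes "\<And>y. y \<noteq> y0 \<Longrightarrow> obj x y0 < obj x y"
  shows "((\<lambda>T. gibbs_mean G t T x) \<longlongrightarrow> y0) (at_right 0)"
proof (rule tendstoI)
  fix e :: real assume "0 < e"
  with assms obtain \<delta> where "0 < \<delta>"
    "\<And>T z. 0 < T \<Longrightarrow> T < \<delta> \<Longrightarrow> dist z x < \<delta> \<Longrightarrow> dist (gibbs_mean G t T z) y0 < e"
    using gibbs_mean_near_minimiser by blast
  then show "\<forall>\<^sub>F T in at_right 0. dist (gibbs_mean G t T x) y0 < e"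
    unfolding eventually_at_right_field by (metis dist_self)
qed

text \<open>Finitely many of the neighbourhoods from \<open>gibbs_mean_near_minimiser\<close> cover
  \<open>K\<close>; in each of them both the Gibbs mean and \<open>p\<close> stay within e / 2 of
  \<open>p\<close> at the centre.\<close>

lemma gibbs_mean_uniform_limit:
  assumes "compact K"
    and min: "\<And>x y. x \<in> K \<Longrightarrow> y \<noteq> p x \<Longrightarrow> obj x (p x) < obj x y"
  shows "uniform_limit K (gibbs_mean G t) p (at_right 0)"
proof (rule uniform_limitI)
  fix e :: real assume "0 < e"
  have "\<exists>\<delta>>0. \<forall>T z. 0 < T \<longrightarrow> T < \<delta> \<longrightarrow> dist z x < \<delta> \<longrightarrow> dist (gibbs_mean G t T z) (p x) < e / 2"
    if "x \<in> K" for x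
    using gibbs_mean_near_minimiser[OF min[OF that], of "e / 2"] \<open>0 < e\<close>
    by (metis half_gt_zero)
  then obtain \<delta> where \<delta>: "\<And>x. x \<in> K \<Longrightarrow> 0 < \<delta> x"
    "\<And>x T z. x \<in> K \<Longrightarrow> 0 < T \<Longrightarrow> T < \<delta> x \<Longrightarrow> dist z x < \<delta> x
      \<Longrightarrow> dist (gibbs_mean G t T z) (p x) < e / 2"
    by metis
  have "K \<subseteq> (\<Union>x\<in>K. ball x (\<delta> x))"
    using \<delta>(1) by (meson UN_I centre_in_ball subsetI)
  then obtain F where F: "F \<subseteq> K" "finite F" "K \<subseteq> (\<Union>x\<in>F. ball x (\<delta> x))"
    by (rule compactE_image[OF \<open>compact K\<close> open_ball])
  \<comment> \<open>Continuity of \<open>p\<close> is not assumed: the local estimate at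
    \<open>x\<close> holds for all small \<open>T\<close> at the base point \<open>z\<close>, and
    its limit as \<open>T\<close> tends to 0 bounds \<open>p z\<close>.\<close>
  have close: "dist (p z) (p x) \<le> e / 2" if "x \<in> K" "z \<in> K" "dist z x < \<delta> x" for x z
  proof (rule tendsto_upperbound)
    show "((\<lambda>T. dist (gibbs_mean G t T z) (p x)) \<longlongrightarrow> dist (p z) (p x)) (at_right 0)"
      by (intro tendsto_dist gibbs_mean_tendsto min that tendsto_const)
    show "\<forall>\<^sub>F T in at_right 0. dist (gibbs_mean G t T z) (p x) \<le> e / 2"
      unfolding eventually_at_right_field using \<delta>[OF that(1)] that(3) by (metis less_imp_le)
  qed simp
  have "\<forall>\<^sub>F T in at_right 0. \<forall>x\<in>F. 0 < T \<and> T < \<delta> x"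
    using F \<delta>(1) unfolding eventually_ball_finite_distrib[OF F(2)] eventually_at_right_field
    by blast
  then show "\<forall>\<^sub>F T in at_right 0. \<forall>z\<in>K. dist (gibbs_mean G t T z) (p z) < e"
  proof eventually_elim
    fix T assume T: "\<forall>x\<in>F. 0 < T \<and> T < \<delta> x"
    show "\<forall>z\<in>K. dist (gibbs_mean G t T z) (p z) < e"
    proof
      fix z assume "z \<in> K"
      then obtain x where "x \<in> F" "z \<in> ball x (\<delta> x)"
        using F(3) by blast
      then have x: "x \<in> F" "x \<in> K" "dist z x < \<delta> x"
        using F(1) by (auto simp: dist_commute)
      then have "dist (gibbs_mean G t T z) (p x) < e / 2"
        using T \<delta>(2) by blast
      moreover have "dist (p z) (p x) \<le> e / 2"
        using close x \<open>z \<in> K\<close> by blast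
      ultimately show "dist (gibbs_mean G t T z) (p z) < e"
        using dist_triangle2[of "gibbs_mean G t T z" "p z" "p x"] by linarith
    qed
  qed
qed

end

text \<open>\<open>gradient\<close> carries information only at points of differentiability. The
  first two conjuncts supply such points; for large \<open>t\<close> distinct minimisers can put a
  kink in the envelope, so both limits are stated where it is differentiable.\<close>

theorem proposition4p26:
  fixes G :: "real ^ 'd \<Rightarrow> real" and \<rho> t_max t :: real
  assumes nonneg: "\<And>x. 0 \<le> G x"
    and integrable: "integrable lborel (\<lambda>x. exp (- G x))"
    and loc_bounded: "locally_bounded G"
    and rho_pos: "0 < \<rho>"
    and weakly_convex: "convex_on UNIV (\<lambda>x. G x + \<rho> / 2 * (norm x)\<^sup>2)"
    and convex_outside: "\<exists>M>0. \<forall>x\<in>- cball 0 M. \<forall>y\<in>- cball 0 M. \<forall>u\<in>{0..1}.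
           G (u *\<^sub>R x + (1 - u) *\<^sub>R y) \<le> u * G x + (1 - u) * G y"
    and t_max: "0 < t_max" "t_max < 1 / \<rho>"
    and growth: "(\<integral>\<^sup>+x. (subgradient_growth G t_max (norm x))\<^sup>2
           * ennreal (exp (- moreau_envelope G t_max x)) \<partial>lborel) < \<infinity>"
    and t_pos: "0 < t"
  shows "(\<forall>T>0. \<forall>x. diffusion_potential G t T differentiable (at x))
    \<and> (t < 1 / \<rho> \<longrightarrow> (\<forall>x. moreau_envelope G t differentiable (at x)))
    \<and> (\<forall>x. moreau_envelope G t differentiable (at x) \<longrightarrow>
          ((\<lambda>T. gradient (diffusion_potential G t T) x)
             \<longlongrightarrow> gradient (moreau_envelope G t) x) (at_right 0))
    \<and> ((\<forall>x. G differentiable (at x)) \<and> locally_lipschitz (gradient G) \<longrightarrow>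
          (\<forall>K. compact K \<and> (\<forall>x\<in>K. moreau_envelope G t differentiable (at x)) \<longrightarrow>
             uniform_limit K (\<lambda>T. gradient (diffusion_potential G t T))
               (gradient (moreau_envelope G t)) (at_right 0)))"
proof -
  \<comment> \<open>A finite convex function on an open set is continuous; subtracting the quadratic
    again yields continuity of \<open>G\<close>.\<close>
  have "continuous_on UNIV (\<lambda>x. G x + \<rho> / 2 * (norm x)\<^sup>2 - \<rho> / 2 * (norm x)\<^sup>2)"
    by (intro continuous_on_diff convex_on_continuous weakly_convex open_UNIV continuous_intros)
  then interpret moreau_setting G t
    by unfold_locales (use nonneg t_pos in auto)
  have potential_GDERIV: "GDERIV (diffusion_potential G t T) x :> (x - gibbs_mean G t T x) /\<^sub>R t"
    if "0 < T" for T x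
  proof -
    have "- G y / T - 1 / (2 * T * t) * (norm (x - y))\<^sup>2 = - obj x y / T" for x y
      using that t_pos by (simp add: prox_objective_def field_simps)
    then have "diffusion_potential G t T = (\<lambda>x. - T * ln (1 / (2 * pi * T * t) powr (real CARD('d) / 2)
        * (\<integral>y. weight T x y \<partial>lborel)))"
      by (simp only: fun_eq_iff diffusion_potential_def gibbs_weight_def simp_thms)
    then show ?thesis
      using free_energy_GDERIV[OF that, of "1 / (2 * pi * T * t) powr (real CARD('d) / 2)" x]
        that t_pos by simp
  qed
  \<comment> \<open>An arbitrary choice among the minimisers, forced wherever the envelope is
    differentiable.\<close>
  define p where "p x = (SOME y. \<forall>z. obj x y \<le> obj x z)" for x
  have p: "obj x (p x) \<le> obj x z" for x z
  proof -
    have "\<exists>y. \<forall>z. obj x y \<le> obj x z" using obtain_minimiser by metis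
    from someI_ex[OF this] show ?thesis unfolding p_def by blast
  qed
  have grad_env: "gradient env x = (x - p x) /\<^sub>R t" if "env differentiable (at x)" for x
    by (intro gradient_eqI env_GDERIV that p)
  have grad_potential: "\<forall>\<^sub>F T in at_right 0.
      \<forall>x. (x - gibbs_mean G t T x) /\<^sub>R t = gradient (diffusion_potential G t T) x"
    using eventually_at_right_less[of "0::real"]
    by eventually_elim (metis gradient_eqI potential_GDERIV)
  have uniform: "uniform_limit K (\<lambda>T. gradient (diffusion_potential G t T)) (gradient env) (at_right 0)"
    if "compact K" and diff: "\<forall>x\<in>K. env differentiable (at x)" for K
  proof -
    have "uniform_limit K (\<lambda>T x. (x - gibbs_mean G t T x) /\<^sub>R t) (\<lambda>x. (x - p x) /\<^sub>R t) (at_right 0)"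
      using minimiser_unique p diff
      by (intro bounded_linear.uniform_limit[OF bounded_linear_scaleR_right] uniform_limit_minus
          uniform_limit_const gibbs_mean_uniform_limit \<open>compact K\<close>) blast
    then show ?thesis
      by (rule uniform_limit_cong[THEN iffD1, rotated 2])
         (use grad_potential diff grad_env in \<open>auto elim: eventually_mono\<close>)
  qed
  \<comment> \<open>Pointwise convergence is uniform convergence on the compact set
    \<open>{x}\<close>.\<close>
  have "((\<lambda>T. gradient (diffusion_potential G t T) x) \<longlongrightarrow> gradient env x) (at_right 0)"
    if "env differentiable (at x)" for x
    using uniform[of "{x}"] that by (auto intro: tendsto_uniform_limitI)
  moreover have "diffusion_potential G t T differentiable (at x)" if "0 < T" for T x
    using potential_GDERIV[OF that] unfolding gderiv_def by (rule differentiableI)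
  moreover have "env differentiable (at x)" if "t < 1 / \<rho>" for x
    using env_differentiable[OF that rho_pos weakly_convex] .
  ultimately show ?thesis
    using uniform by blast
qed

end
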